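(* For all probabilistic process terms $e,f\in\mathsf{PTerm}$, if $e\equiv f$ (probabilistic provable equivalence), then for every nonempty complete metric space $(M,d)$ and every $\sigma:A\to\operatorname{Con}(M,d)$, $\hat\delta_\sigma(e)=\hat\delta_\sigma(f)$.
   Context: $A$ is a fixed finite set of actions. Probabilistic terms over countably many variables: $e::= v\mid ae\mid e_1\oplus_r e_2\mid\mu v\,e$ with $a\in A$, $r\in[0,1]$. $\mathsf{PTerm}$ is the set of closed (each occurrence of $v$ in the scope of $\mu v$) and guarded (each such occurrence, inside its binder, within a prefix $a(-)$) probabilistic terms; $e[g/v]$ is capture-avoiding substitution. The syntactic LMC $\delta:\mathsf{PTerm}\to\mathcal D(A\times\mathsf{PTerm})$ is: $\delta(ae)(b,f)=1$ if $b=a,f=e$, else $0$; $\delta(e_1\oplus_r e_2)(b,f)=r\,\delta(e_1)(b,f)+(1-r)\delta(e_2)(b,f)$; $\delta(\mu v\,e)=\delta(e[\mu v\,e/v])$. Write $e\xrightarrow{r\mid a}e'$ when $\delta(e)(a,e')=r$. $\operatorname{trm}(e)$ is the unique Borel probability measure on $A^\omega$ (basic open sets $B_w$ = streams with prefix $w$) with $\operatorname{trm}(e)(B_{a_1\cdots a_n})=\sum\{r_1\cdots r_n:e\xrightarrow{r_1\mid a_1}\cdots\xrightarrow{r_n\mid a_n}e_n\}$. For contractions $\sigma:A\to\operatorname{Con}(M,d)$, $\sigma_\omega(a_1,\dots)=\lim_n\sigma_{a_1}\cdots\sigma_{a_n}(p)$ and $\hat\delta_\sigma(e)=\sigma_\omega^\#\operatorname{trm}(e)$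 (pushforward). Provable equivalence $\equiv$ on probabilistic terms: the smallest equivalence relation closed under equational logic and (ID) $e\oplus_r e\equiv e$; (CM) $e_1\oplus_r e_2\equiv e_2\oplus_{1-r}e_1$; (AS) $(e_1\oplus_r e_2)\oplus_s e_3\equiv e_1\oplus_{rs}(e_2\oplus_{s(1-r)/(1-rs)}e_3)$ for $rs\neq1$; (DS) $a(e_1\oplus_r e_2)\equiv ae_1\oplus_r ae_2$; (FP) $\mu v\,e\equiv e[\mu v\,e/v]$; (CN) if $e_i\equiv f_i$ for all $i$ then $g[\vec e/\vec v]\equiv g[\vec f/\vec v]$ ($g$ with exactly free variables $v_1,\dots,v_n$, no variable free in any $f_i$ bound in $g$); (AE) $\mu w\,e\equiv\mu v\,e[v/w]$ with $v$ not free in $e$; (UA) if $g\equiv e[g/v]$ then $g\equiv\mu v\,e$.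
   Formalization: Provable equivalence is taken on guarded (possibly open) terms with labels in [0,1] rather than on all probabilistic terms; with unguarded terms, (UA) applied to g ≡ v[g/v] gives g ≡ μv v for every g, so all terms would be equivalent and the claim would fail. *)

theory Defs
  imports "HOL-Probability.Probability"
begin

section \<open>Probabilistic terms\<close>

text \<open>The finite set of actions is the universe of a type of class \<^class>\<open>finite\<close>; variables are
  natural numbers. The restriction of the labels to the unit interval is the
  predicate \<open>unit_labels\<close> below.\<close>

datatype 'a pterm =
    Var nat
  | Act 'a "'a pterm"
  | Choice real "'a pterm" "'a pterm"
  | Mu nat "'a pterm"

primrec unit_labels :: "'a pterm \<Rightarrow> bool" where
  "unit_labels (Var v) = True"
| "unit_labels (Act a e) = unit_labels e"
| "unit_labels (Choice r e1 e2) = (r \<in> {0..1} \<and> unit_labels e1 \<and> unit_labels e2)"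
| "unit_labels (Mu v e) = unit_labels e"

primrec FV :: "'a pterm \<Rightarrow> nat set" where
  "FV (Var v) = {v}"
| "FV (Act a e) = FV e"
| "FV (Choice r e1 e2) = FV e1 \<union> FV e2"
| "FV (Mu v e) = FV e - {v}"

primrec BV :: "'a pterm \<Rightarrow> nat set" where
  "BV (Var v) = {}"
| "BV (Act a e) = BV e"
| "BV (Choice r e1 e2) = BV e1 \<union> BV e2"
| "BV (Mu v e) = insert v (BV e)"

text \<open>\<open>UV e\<close> consists of the variables with a free occurrence in \<open>e\<close> that is not under a prefix.\<close>

primrec UV :: "'a pterm \<Rightarrow> nat set" where
  "UV (Var v) = {v}"
| "UV (Act a e) = {}"
| "UV (Choice r e1 e2) = UV e1 \<union> UV e2"
| "UV (Mu v e) = UV e - {v}"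

text \<open>Guardedness restricts bound occurrences only: the prefix must lie between the
  occurrence and its binder. Free variables of an open term may be unguarded.\<close>

primrec guarded :: "'a pterm \<Rightarrow> bool" where
  "guarded (Var v) = True"
| "guarded (Act a e) = guarded e"
| "guarded (Choice r e1 e2) = (guarded e1 \<and> guarded e2)"
| "guarded (Mu v e) = (v \<notin> UV e \<and> guarded e)"

definition OTerm :: "'a pterm set" where
  "OTerm = {e. unit_labels e \<and> guarded e}"

definition PTerm :: "'a pterm set" where
  "PTerm = {e. unit_labels e \<and> guarded e \<and> FV e = {}}"


section \<open>Capture-avoiding substitution\<close>

text \<open>Terms are not identified up to renaming of bound variables. A binder is renamed only if it
  would capture, and then to the least variable that causes no capture.\<close>

definition captured :: "(nat \<Rightarrow> 'a pterm) \<Rightarrow> nat set \<Rightarrow> nat set" where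
  "captured \<theta> V = (\<Union>u\<in>V. FV (\<theta> u))"

definition binder_for :: "nat \<Rightarrow> nat set \<Rightarrow> nat" where
  "binder_for v C = (if v \<in> C then (LEAST w. w \<notin> C) else v)"

primrec psubst :: "'a pterm \<Rightarrow> (nat \<Rightarrow> 'a pterm) \<Rightarrow> 'a pterm" where
  "psubst (Var v) \<theta> = \<theta> v"
| "psubst (Act a e) \<theta> = Act a (psubst e \<theta>)"
| "psubst (Choice r e1 e2) \<theta> = Choice r (psubst e1 \<theta>) (psubst e2 \<theta>)"
| "psubst (Mu v e) \<theta> =
     (let w = binder_for v (captured \<theta> (FV e - {v}))
      in Mu w (psubst e (\<theta>(v := Var w))))"

abbreviation subst :: "'a pterm \<Rightarrow> 'a pterm \<Rightarrow> nat \<Rightarrow> 'a pterm"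
    ("_[_'/\<^sub>t_]" [1000, 0, 0] 1000) where
  "e[g/\<^sub>tv] \<equiv> psubst e (Var(v := g))"


section \<open>The syntactic labelled Markov chain\<close>

primrec height :: "'a pterm \<Rightarrow> nat" where
  "height (Var v) = 0"
| "height (Act a e) = 0"
| "height (Choice r e1 e2) = Suc (max (height e1) (height e2))"
| "height (Mu v e) = Suc (height e)"

lemma height_psubst:
  "(\<And>u. u \<in> UV e \<Longrightarrow> height (\<theta> u) = 0) \<Longrightarrow> height (psubst e \<theta>) = height e"
  by (induction e arbitrary: \<theta>) (auto simp: Let_def)

text \<open>Outside guarded closed terms the value is irrelevant; the guard on the last equation only
  serves termination.\<close>

function \<delta> :: "'a pterm \<Rightarrow> ('a \<times> 'a pterm) pmf" where
  "\<delta> (Var v) = undefined"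
| "\<delta> (Act a e) = return_pmf (a, e)"
| "\<delta> (Choice r e1 e2) = bind_pmf (bernoulli_pmf r) (\<lambda>b. if b then \<delta> e1 else \<delta> e2)"
| "\<delta> (Mu v e) = (if v \<notin> UV e then \<delta> (e[Mu v e/\<^sub>tv]) else undefined)"
  by pat_completeness auto
termination
  by (relation "Wellfounded.measure height")
     (auto simp: less_Suc_eq_le intro!: height_psubst[THEN eq_refl])

lemma pmf_\<delta>_Act: "pmf (\<delta> (Act a e)) (b, f) = (if b = a \<and> f = e then 1 else 0)"
  by (auto simp: pmf_return)

lemma pmf_\<delta>_Choice:
  assumes "r \<in> {0..1}"
  shows "pmf (\<delta> (Choice r e1 e2)) (b, f) = r * pmf (\<delta> e1) (b, f) + (1 - r) * pmf (\<delta> e2) (b, f)"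
  using assms by (simp add: pmf_bind)

lemma \<delta>_Mu: "guarded (Mu v e) \<Longrightarrow> \<delta> (Mu v e) = \<delta> (e[Mu v e/\<^sub>tv])"
  by simp


section \<open>Trace measures\<close>

primrec path_prob :: "'a pterm \<Rightarrow> ('a \<times> 'a pterm) list \<Rightarrow> real" where
  "path_prob e [] = 1"
| "path_prob e (s # p) = pmf (\<delta> e) s * path_prob (snd s) p"

text \<open>The sum ranges over all sequences \<open>e\<^sub>1, \<dots>, e\<^sub>n\<close> of targets, so that paths with the same
  labels are counted separately.\<close>

definition trace_prob :: "'a pterm \<Rightarrow> 'a list \<Rightarrow> real" where
  "trace_prob e w = (\<Sum>\<^sub>\<infinity>es\<in>{es. length es = length w}. path_prob e (zip w es))"

definition cyl :: "'a list \<Rightarrow> 'a stream set" where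
  "cyl w = {s. stake (length w) s = w}"

definition stream_borel :: "'a stream measure" where
  "stream_borel = sigma UNIV {U. openin (topology_generated_by (range cyl)) U}"

definition trm :: "'a pterm \<Rightarrow> 'a stream measure" where
  "trm e = (THE \<mu>. prob_space \<mu> \<and> sets \<mu> = sets stream_borel \<and>
                  (\<forall>w. measure \<mu> (cyl w) = trace_prob e w))"


section \<open>Fractal measures\<close>

definition contraction :: "('m::metric_space \<Rightarrow> 'm) \<Rightarrow> bool" where
  "contraction f \<longleftrightarrow> (\<exists>c<1. c-lipschitz_on UNIV f)"

definition stream_lim :: "('a \<Rightarrow> 'm::metric_space \<Rightarrow> 'm) \<Rightarrow> 'a stream \<Rightarrow> 'm" where
  "stream_lim \<sigma> s = (THE x. \<forall>p. (\<lambda>n. foldr \<sigma> (stake n s) p) \<longlonglongrightarrow> x)"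

definition fractal_measure :: "('a \<Rightarrow> 'm::metric_space \<Rightarrow> 'm) \<Rightarrow> 'a pterm \<Rightarrow> 'm measure" where
  "fractal_measure \<sigma> e = distr (trm e) borel (stream_lim \<sigma>)"


section \<open>Provable equivalence\<close>

text \<open>The relation lives on guarded, possibly open terms. Without guardedness \<open>UA\<close> would prove
  every \<open>g\<close> equivalent to \<open>Mu v (Var v)\<close>. The first four rules are equational logic; closure under
  term contexts is \<open>CN\<close>. In \<open>CN\<close> the tuples substituted for the free variables of \<open>g\<close> are given
  by functions, whose values elsewhere do not matter.\<close>

inductive prov_eq :: "'a pterm \<Rightarrow> 'a pterm \<Rightarrow> bool" (infix "\<simeq>" 50) where
  Refl: "e \<in> OTerm \<Longrightarrow> e \<simeq> e"
| Sym: "e \<simeq> f \<Longrightarrow> f \<simeq> e"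
| Trans: "e \<simeq> f \<Longrightarrow> f \<simeq> g \<Longrightarrow> e \<simeq> g"
| Subst: "e \<simeq> f \<Longrightarrow> g \<in> OTerm \<Longrightarrow> e[g/\<^sub>tv] \<simeq> f[g/\<^sub>tv]"
| ID: "e \<in> OTerm \<Longrightarrow> r \<in> {0..1} \<Longrightarrow> Choice r e e \<simeq> e"
| CM: "e1 \<in> OTerm \<Longrightarrow> e2 \<in> OTerm \<Longrightarrow> r \<in> {0..1} \<Longrightarrow>
    Choice r e1 e2 \<simeq> Choice (1 - r) e2 e1"
| AS: "e1 \<in> OTerm \<Longrightarrow> e2 \<in> OTerm \<Longrightarrow> e3 \<in> OTerm \<Longrightarrow> r \<in> {0..1} \<Longrightarrow> s \<in> {0..1} \<Longrightarrow>
    r * s \<noteq> 1 \<Longrightarrow>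
    Choice s (Choice r e1 e2) e3 \<simeq>
    Choice (r * s) e1 (Choice (s * (1 - r) / (1 - r * s)) e2 e3)"
| DS: "e1 \<in> OTerm \<Longrightarrow> e2 \<in> OTerm \<Longrightarrow> r \<in> {0..1} \<Longrightarrow>
    Act a (Choice r e1 e2) \<simeq> Choice r (Act a e1) (Act a e2)"
| FP: "Mu v e \<in> OTerm \<Longrightarrow> Mu v e \<simeq> e[Mu v e/\<^sub>tv]"
| CN: "g \<in> OTerm \<Longrightarrow> (\<And>v. v \<in> FV g \<Longrightarrow> \<theta> v \<simeq> \<eta> v) \<Longrightarrow>
    (\<And>v. v \<in> FV g \<Longrightarrow> FV (\<eta> v) \<inter> BV g = {}) \<Longrightarrow> psubst g \<theta> \<simeq> psubst g \<eta>"
| AE: "Mu w e \<in> OTerm \<Longrightarrow> v \<notin> FV e \<Longrightarrow> Mu w e \<simeq> Mu v (e[Var v/\<^sub>tw])"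
| UA: "Mu v e \<in> OTerm \<Longrightarrow> g \<simeq> e[g/\<^sub>tv] \<Longrightarrow> g \<simeq> Mu v e"

end

(* Terms, including open ones, denote functions on finite words: a term denotes the map sending w
   to the probability that its trace starts with w, relative to an environment for the free
   variables. A prefix consumes a letter, so the functional of a guarded binder determines its
   value at a word from the values of its argument at shorter words; it therefore has exactly one
   fixed point. Existence of the fixed point validates FP and uniqueness validates UA. On closed
   guarded terms the denotation is the trace probability, which determines the trace measure. *)
theory Submission imports Defs begin

section \<open>Denotations of open terms\<close>

text \<open>The empty word is a prefix of every trace, hence the value 1. Values at words of length
  n + 1 depend on \<open>x\<close> only at length n; all contractivity below stems from this
  shift.\<close>

primrec prefix_den :: "'a \<Rightarrow> ('a list \<Rightarrow> real) \<Rightarrow> 'a list \<Rightarrow> real" where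
  "prefix_den a x [] = 1"
| "prefix_den a x (b # w) = (if b = a then x w else 0)"

text \<open>If \<open>v \<notin> UV e\<close>, the value at \<open>w\<close> of the iterates is constant from step \<open>Suc (length w)\<close> on,
  whatever the starting point. For other terms the equation for \<open>Mu\<close> has no meaning.\<close>

primrec den :: "'a pterm \<Rightarrow> (nat \<Rightarrow> 'a list \<Rightarrow> real) \<Rightarrow> 'a list \<Rightarrow> real" where
  "den (Var v) \<rho> = \<rho> v"
| "den (Act a e) \<rho> = prefix_den a (den e \<rho>)"
| "den (Choice r e1 e2) \<rho> = (\<lambda>w. r * den e1 \<rho> w + (1 - r) * den e2 \<rho> w)"
| "den (Mu v e) \<rho> =
     (\<lambda>w. ((\<lambda>x. den e (\<rho>(v := x))) ^^ Suc (length w)) (\<lambda>_. 0) w)"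

lemma den_cong_FV: "(\<And>u. u \<in> FV e \<Longrightarrow> \<rho> u = \<rho>' u) \<Longrightarrow> den e \<rho> = den e \<rho>'"
proof (induction e arbitrary: \<rho> \<rho>')
  case (Act a e)
  then show ?case by (metis FV.simps(2) den.simps(2))
next
  case (Choice r e1 e2)
  have "den e1 \<rho> = den e1 \<rho>'"
    by (rule Choice.IH(1)) (simp add: Choice.prems)
  moreover have "den e2 \<rho> = den e2 \<rho>'"
    by (rule Choice.IH(2)) (simp add: Choice.prems)
  ultimately show ?case by simp
next
  case (Mu v e)
  have "(\<lambda>x. den e (\<rho>(v := x))) = (\<lambda>x. den e (\<rho>'(v := x)))"
    by (rule ext, rule Mu.IH) (use Mu.prems in auto)
  then show ?case by simp
qed auto

text \<open>An unguarded variable is read at \<open>w\<close> itself, a guarded one only after a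
  prefix has removed a letter; so length \<open>n\<close> matters only for variables in
  \<open>UV e\<close>. The bound \<open>n\<close> is kept apart from \<open>length w\<close> because
  the \<open>Mu\<close> case compares iterates at all words up to \<open>n\<close>.\<close>

lemma den_nonexpansive:
  assumes "\<And>u w. u \<in> UV e \<Longrightarrow> length w \<le> n \<Longrightarrow> \<rho> u w = \<rho>' u w"
    and "\<And>u w. length w < n \<Longrightarrow> \<rho> u w = \<rho>' u w"
    and "length w \<le> n"
  shows "den e \<rho> w = den e \<rho>' w"
  using assms
proof (induction e arbitrary: \<rho> \<rho>' n w)
  case (Act a e)
  show ?case
  proof (cases w)
    case (Cons b w')
    have "den e \<rho> w' = den e \<rho>' w'"
      by (rule Act.IH[where n = "length w'"]) (use Act.prems Cons in auto)
    then show ?thesis by (simp add: Cons)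
  qed simp
next
  case (Choice r e1 e2)
  have "den e1 \<rho> w = den e1 \<rho>' w"
    by (rule Choice.IH(1)[where n = n]) (use Choice.prems in auto)
  moreover have "den e2 \<rho> w = den e2 \<rho>' w"
    by (rule Choice.IH(2)[where n = n]) (use Choice.prems in auto)
  ultimately show ?case by simp
next
  case (Mu v e)
  define F where "F = (\<lambda>\<rho> x. den e (\<rho>(v := x)))"
  have "(F \<rho> ^^ k) (\<lambda>_. 0) w = (F \<rho>' ^^ k) (\<lambda>_. 0) w" if "length w \<le> n" for k w
    using that
  proof (induction k arbitrary: w)
    case (Suc k)
    have "den e (\<rho>(v := (F \<rho> ^^ k) (\<lambda>_. 0))) w = den e (\<rho>'(v := (F \<rho>' ^^ k) (\<lambda>_. 0))) w"
      by (rule Mu.IH[where n = n]) (use Mu.prems Suc in auto)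
    then show ?case by (simp add: F_def)
  qed simp
  from this[OF Mu.prems(3)] show ?case unfolding den.simps F_def .
qed auto

text \<open>A guarded \<open>v\<close> is read only at words shorter than \<open>w\<close>. This is
  contraction in the ultrametric where functions are close if they agree on all short words.\<close>

lemma den_contractive:
  assumes "v \<notin> UV e" and "\<And>w'. length w' < length w \<Longrightarrow> x w' = y w'"
  shows "den e (\<rho>(v := x)) w = den e (\<rho>(v := y)) w"
  by (rule den_nonexpansive[where n = "length w"]) (use assms in auto)

lemma den_fixed_point_unique:
  assumes "v \<notin> UV e" and "x = den e (\<rho>(v := x))" and "y = den e (\<rho>(v := y))"
  shows "x = y"
proof
  show "x w = y w" for w
  proof (induction w rule: length_induct)
    case (1 w)
    have "den e (\<rho>(v := x)) w = den e (\<rho>(v := y)) w"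
      by (rule den_contractive) (use assms(1) 1 in auto)
    then show ?case using assms(2,3) by metis
  qed
qed

lemma den_Mu_unfold:
  assumes "v \<notin> UV e"
  shows "den (Mu v e) \<rho> = den e (\<rho>(v := den (Mu v e) \<rho>))"
proof
  fix w
  define F where "F = (\<lambda>x. den e (\<rho>(v := x)))"
  have F_contractive: "F x w = F y w" if "\<And>w'. length w' < length w \<Longrightarrow> x w' = y w'" for x y w
    unfolding F_def by (rule den_contractive[OF assms that])
  \<comment> \<open>Each application of \<open>F\<close> extends agreement by one letter, whatever
    the two iterates were before; the case \<open>k = 0\<close> is vacuous.\<close>
  have iterates_stable: "(F ^^ k) (\<lambda>_. 0) w = (F ^^ l) (\<lambda>_. 0) w"
    if "length w < k" "length w < l" for k l w
    using that
  proof (induction k arbitrary: l w)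
    case (Suc k)
    then obtain l' where l: "l = Suc l'" by (cases l) auto
    show ?case
      unfolding l funpow.simps comp_def by (rule F_contractive, rule Suc.IH) (use Suc.prems l in auto)
  qed simp
  \<comment> \<open>The outermost of the \<open>Suc (length w)\<close> applications is peeled off;
    the remaining \<open>length w\<close> already suffice at every strictly shorter word.\<close>
  have "den (Mu v e) \<rho> w = F ((F ^^ length w) (\<lambda>_. 0)) w"
    by (simp add: F_def)
  also have "\<dots> = F (den (Mu v e) \<rho>) w"
  proof (rule F_contractive)
    fix w' :: "'a list" assume "length w' < length w"
    then have "(F ^^ length w) (\<lambda>_. 0) w' = (F ^^ Suc (length w')) (\<lambda>_. 0) w'"
      by (intro iterates_stable) auto
    then show "(F ^^ length w) (\<lambda>_. 0) w' = den (Mu v e) \<rho> w'"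
      unfolding den.simps F_def .
  qed
  finally show "den (Mu v e) \<rho> w = den e (\<rho>(v := den (Mu v e) \<rho>)) w"
    by (simp only: F_def)
qed

section \<open>Substitution\<close>

lemma finite_FV: "finite (FV e)"
  by (induction e) auto

lemma binder_for_notin: "finite C \<Longrightarrow> binder_for v C \<notin> C"
  unfolding binder_for_def
  using LeastI_ex[of "\<lambda>w. w \<notin> C"] ex_new_if_finite[OF infinite_UNIV_nat, of C] by auto

lemma binder_for_captured:
  "u \<in> V \<Longrightarrow> finite V \<Longrightarrow> binder_for v (captured \<theta> V) \<notin> FV (\<theta> u)"
  using binder_for_notin[of "captured \<theta> V" v] by (auto simp: captured_def finite_FV)

text \<open>Renaming a binder is invisible to denotations: the chosen binder is fresh for all terms
  substituted under it, so updating the environment there leaves their values unchanged.\<close>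

lemma den_psubst: "den (psubst e \<theta>) \<rho> = den e (\<lambda>u. den (\<theta> u) \<rho>)"
proof (induction e arbitrary: \<theta> \<rho>)
  case (Mu v e)
  define w where "w = binder_for v (captured \<theta> (FV e - {v}))"
  have fresh: "w \<notin> FV (\<theta> u)" if "u \<in> FV e" "u \<noteq> v" for u
    unfolding w_def by (rule binder_for_captured) (use that finite_FV in auto)
  have "den (psubst e (\<theta>(v := Var w))) (\<rho>(w := x)) = den e ((\<lambda>u. den (\<theta> u) \<rho>)(v := x))" for x
    unfolding Mu.IH
  proof (rule den_cong_FV)
    fix u assume "u \<in> FV e"
    then have "den (\<theta> u) (\<rho>(w := x)) = den (\<theta> u) \<rho>" if "u \<noteq> v"
      by (intro den_cong_FV) (use fresh that in auto)
    then show "den ((\<theta>(v := Var w)) u) (\<rho>(w := x)) = ((\<lambda>u. den (\<theta> u) \<rho>)(v := x)) u"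
      by simp
  qed
  then show ?case by (simp add: Let_def w_def)
qed simp_all

lemma den_subst: "den (e[g/\<^sub>tv]) \<rho> = den e (\<rho>(v := den g \<rho>))"
proof -
  have "(\<lambda>u. den ((Var(v := g)) u) \<rho>) = \<rho>(v := den g \<rho>)" by auto
  then show ?thesis by (simp only: den_psubst)
qed

lemma UV_subset_FV: "UV e \<subseteq> FV e"
  by (induction e) auto

lemma FV_psubst: "FV (psubst e \<theta>) \<subseteq> (\<Union>u\<in>FV e. FV (\<theta> u))"
proof (induction e arbitrary: \<theta>)
  case (Choice r e1 e2)
  show ?case using Choice[of \<theta>] by auto
next
  case (Mu v e)
  define w where "w = binder_for v (captured \<theta> (FV e - {v}))"
  have "FV (psubst e (\<theta>(v := Var w))) \<subseteq> (\<Union>u\<in>FV e. FV ((\<theta>(v := Var w)) u))"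
    by (rule Mu)
  also have "\<dots> \<subseteq> insert w (\<Union>u\<in>FV e - {v}. FV (\<theta> u))"
    by (auto split: if_splits)
  finally show ?case by (auto simp: Let_def w_def)
qed auto

lemma UV_psubst: "UV (psubst e \<theta>) \<subseteq> (\<Union>u\<in>UV e. UV (\<theta> u))"
proof (induction e arbitrary: \<theta>)
  case (Choice r e1 e2)
  show ?case using Choice[of \<theta>] by auto
next
  case (Mu v e)
  define w where "w = binder_for v (captured \<theta> (FV e - {v}))"
  have "UV (psubst e (\<theta>(v := Var w))) \<subseteq> (\<Union>u\<in>UV e. UV ((\<theta>(v := Var w)) u))"
    by (rule Mu)
  also have "\<dots> \<subseteq> insert w (\<Union>u\<in>UV e - {v}. UV (\<theta> u))"
    by (auto split: if_splits)
  finally show ?case by (auto simp: Let_def w_def)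
qed auto

text \<open>A new binder could be unguarded in its body only through the old one, excluded by
  guardedness of the original term, or through capture, excluded by
  \<open>binder_for\<close>.\<close>

lemma guarded_psubst: "guarded e \<Longrightarrow> (\<And>u. guarded (\<theta> u)) \<Longrightarrow> guarded (psubst e \<theta>)"
proof (induction e arbitrary: \<theta>)
  case (Mu v e)
  define w where "w = binder_for v (captured \<theta> (FV e - {v}))"
  have "w \<notin> FV (\<theta> u)" if "u \<in> FV e" "u \<noteq> v" for u
    unfolding w_def by (rule binder_for_captured) (use that finite_FV in auto)
  then have "w \<notin> UV (\<theta> u)" if "u \<in> UV e" "u \<noteq> v" for u
    using that UV_subset_FV by blast
  then have "w \<notin> UV (psubst e (\<theta>(v := Var w)))"
    using UV_psubst[of e "\<theta>(v := Var w)"] Mu.prems(1)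
    by (auto split: if_splits dest!: subsetD)
  moreover have "guarded (psubst e (\<theta>(v := Var w)))"
    by (rule Mu.IH) (use Mu.prems in auto)
  ultimately show ?case by (simp add: Let_def w_def)
qed simp_all

lemma unit_labels_psubst:
  "unit_labels e \<Longrightarrow> (\<And>u. unit_labels (\<theta> u)) \<Longrightarrow> unit_labels (psubst e \<theta>)"
  by (induction e arbitrary: \<theta>) (auto simp: Let_def)

lemma PTerm_unfold:
  assumes "Mu v e \<in> PTerm"
  shows "e[Mu v e/\<^sub>tv] \<in> PTerm"
proof -
  have "guarded (e[Mu v e/\<^sub>tv])" "unit_labels (e[Mu v e/\<^sub>tv])"
    by (rule guarded_psubst unit_labels_psubst; use assms in \<open>simp add: PTerm_def\<close>)+
  moreover have "(\<Union>u\<in>FV e. FV ((Var(v := Mu v e)) u)) = {}"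
    using assms by (auto simp: PTerm_def)
  then have "FV (e[Mu v e/\<^sub>tv]) = {}"
    using FV_psubst[of e "Var(v := Mu v e)"] by (simp only: subset_empty)
  ultimately show ?thesis by (simp add: PTerm_def)
qed

section \<open>Soundness of the axioms\<close>

text \<open>Derivations may pass through open terms, so all environments are treated at once; the
  rule \<open>Subst\<close> moves to an updated one.\<close>

lemma prov_eq_den: "e \<simeq> f \<Longrightarrow> den e \<rho> = den f \<rho>"
proof (induction arbitrary: \<rho> rule: prov_eq.induct)
  case (Subst e f g v)
  then show ?case by (simp only: den_subst)
next
  case (ID e r)
  then show ?case by (simp add: algebra_simps)
next
  case (CM e1 e2 r)
  then show ?case by (simp add: algebra_simps)
next
  case (AS e1 e2 e3 r s)
  then have "1 - r * s \<noteq> 0" by simp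
  \<comment> \<open>The inner weight of \<open>AS\<close> enters only through this product, which
    keeps the division out of the remaining identity.\<close>
  then have t: "(1 - r * s) * (s * (1 - r) / (1 - r * s)) = s * (1 - r)" by simp
  have "s * (r * x + (1 - r) * y) + (1 - s) * z =
      r * s * x + (1 - r * s) * (t * y + (1 - t) * z)"
    if "(1 - r * s) * t = s * (1 - r)" for t x y z
  proof -
    have "r * s * x + (1 - r * s) * (t * y + (1 - t) * z) =
        r * s * x + (1 - r * s) * t * y + (1 - r * s - (1 - r * s) * t) * z"
      by (simp add: algebra_simps)
    then show ?thesis unfolding that by (simp add: algebra_simps)
  qed
  from this[OF t] show ?case unfolding den.simps by (rule ext)
next
  case (DS e1 e2 r a)
  \<comment> \<open>At the empty word the weights add up to 1; at other words the prefix is linear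
    in its argument.\<close>
  have "den (Act a (Choice r e1 e2)) \<rho> w = den (Choice r (Act a e1) (Act a e2)) \<rho> w" for w
    by (cases w) auto
  then show ?case by auto
next
  case (FP v e)
  then have "v \<notin> UV e" by (simp add: OTerm_def)
  then show ?case unfolding den_subst by (rule den_Mu_unfold)
next
  case (CN g \<theta> \<eta>)
  show ?case unfolding den_psubst by (rule den_cong_FV) (rule CN.IH)
next
  case (AE w e v)
  have "den (e[Var v/\<^sub>tw]) (\<rho>(v := x)) = den e (\<rho>(w := x))" for x
    unfolding den_subst by (rule den_cong_FV) (use AE in auto)
  then show ?case by simp
next
  case (UA v e g)
  then have "v \<notin> UV e" by (simp add: OTerm_def)
  \<comment> \<open>\<open>g\<close> and \<open>Mu v e\<close> denote fixed points of the same
    contractive functional.\<close>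
  then show ?case
  proof (rule den_fixed_point_unique)
    show "den g \<rho> = den e (\<rho>(v := den g \<rho>))"
      by (rule UA.IH[unfolded den_subst])
    show "den (Mu v e) \<rho> = den e (\<rho>(v := den (Mu v e) \<rho>))"
      by (rule den_Mu_unfold) fact
  qed
qed simp_all

section \<open>Trace probabilities\<close>

lemma path_prob_cong_\<delta>: "\<delta> e = \<delta> f \<Longrightarrow> path_prob e p = path_prob f p"
  by (cases p) auto

lemma path_prob_Choice:
  assumes "r \<in> {0..1}"
  shows "path_prob (Choice r e1 e2) p = r * path_prob e1 p + (1 - r) * path_prob e2 p"
proof (cases p)
  case (Cons s q)
  have "pmf (\<delta> (Choice r e1 e2)) s = r * pmf (\<delta> e1) s + (1 - r) * pmf (\<delta> e2) s"
    using pmf_\<delta>_Choice[OF assms] by (cases s) (simp only:)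
  then show ?thesis
    by (simp only: Cons path_prob.simps distrib_right mult.assoc)
qed simp

text \<open>Only target sequences beginning with \<open>e\<close> have nonzero probability, so the
  sum is reindexed along \<open>(#) e\<close>.\<close>

lemma path_prob_has_sum_Act:
  assumes "((\<lambda>es. path_prob e (zip w es)) has_sum x) {es. length es = length w}"
  shows "((\<lambda>es. path_prob (Act a e) (zip (a # w) es)) has_sum x) {es. length es = length (a # w)}"
proof -
  have "((\<lambda>es. path_prob (Act a e) (zip (a # w) es)) has_sum x)
          ((#) e ` {es. length es = length w})"
    using assms by (subst has_sum_reindex) (auto simp: comp_def)
  moreover have "path_prob (Act a e) (zip (a # w) es) = 0"
    if "es \<in> {es. length es = length (a # w)} - (#) e ` {es. length es = length w}" for es
    using that by (cases es) (auto simp: indicator_def)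
  ultimately show ?thesis
    by (subst has_sum_cong_neutral) auto
qed

text \<open>Nested induction: a prefix shortens the word, whatever the height of its body; a choice
  or an unfolding keeps the word and lowers the height. \<open>has_sum\<close> carries summability
  along, without which an infinite sum would default to 0.\<close>

lemma path_prob_has_sum_den:
  assumes "e \<in> PTerm"
  shows "((\<lambda>es. path_prob e (zip w es)) has_sum den e \<rho> w) {es. length es = length w}"
  using assms
proof (induction w arbitrary: e rule: length_induct)
  case (1 w)
  note shorter = this(1)
  from 1(2) show ?case
  proof (induction "height e" arbitrary: e rule: less_induct)
    case less
    show ?case
    proof (cases e)
      case (Var v)
      then show ?thesis using less.prems by (simp add: PTerm_def)
    next
      case (Act a e')
      then have e': "e' \<in> PTerm" using less.prems by (simp add: PTerm_def)
      consider "w = []" | w' where "w = a # w'" | b w' where "w = b # w'" "b \<noteq> a"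
        by (cases w) auto
      then show ?thesis
      proof cases
        case 1
        then show ?thesis
          using has_sum_finite[of "{[]}" "\<lambda>_. 1 :: real"] by (simp add: Act)
      next
        case 2
        then show ?thesis
          using path_prob_has_sum_Act[of e' w'] shorter e' by (simp add: Act del: path_prob.simps)
      next
        case 3
        have "path_prob e (zip w es) = 0" if "length es = length w" for es
          using that 3 by (cases es) (auto simp: Act)
        then show ?thesis using 3 by (auto simp: Act intro!: has_sum_0)
      qed
    next
      case (Choice r e1 e2)
      then have r: "r \<in> {0..1}" and "e1 \<in> PTerm" "e2 \<in> PTerm"
        using less.prems by (auto simp: PTerm_def)
      then show ?thesis
        unfolding Choice path_prob_Choice[OF r] den.simps
        by (intro has_sum_add has_sum_cmult_right less.hyps) (auto simp: Choice)
    next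
      case (Mu v e')
      let ?f = "e'[Mu v e'/\<^sub>tv]"
      have v: "v \<notin> UV e'" using less.prems by (simp add: Mu PTerm_def)
      \<comment> \<open>A guarded \<open>v\<close> occurs only under prefixes, where
        \<open>height\<close> does not look, so the unfolding is lower than
        \<open>Mu v e'\<close>.\<close>
      have "height ?f = height e'" by (rule height_psubst) (use v in auto)
      moreover have "?f \<in> PTerm" using less.prems PTerm_unfold by (simp add: Mu)
      ultimately have "((\<lambda>es. path_prob ?f (zip w es)) has_sum den ?f \<rho> w)
          {es. length es = length w}"
        by (intro less.hyps) (auto simp: Mu)
      moreover have "path_prob e p = path_prob ?f p" for p
        by (rule path_prob_cong_\<delta>) (simp add: Mu v)
      moreover have "den e \<rho> = den ?f \<rho>"
        unfolding Mu den_subst by (rule den_Mu_unfold[OF v])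
      ultimately show ?thesis by simp
    qed
  qed
qed

lemma trace_prob_eq_den: "e \<in> PTerm \<Longrightarrow> trace_prob e w = den e \<rho> w"
  unfolding trace_prob_def by (rule infsumI) (rule path_prob_has_sum_den)

theorem mainTheorem11:
  fixes e f :: "'a::finite pterm" and \<sigma> :: "'a \<Rightarrow> 'm::complete_space \<Rightarrow> 'm"
  assumes "e \<in> PTerm" and "f \<in> PTerm" and "e \<simeq> f"
    and "\<And>a. contraction (\<sigma> a)"
  shows "fractal_measure \<sigma> e = fractal_measure \<sigma> f"
proof -
  have "trace_prob e w = trace_prob f w" for w
    using assms(1-3) trace_prob_eq_den prov_eq_den by metis
  \<comment> \<open>The definite description \<open>trm\<close> mentions its term only through trace
    probabilities, so both descriptions coincide.\<close>
  then show ?thesis by (simp add: fractal_measure_def trm_def)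
qed

end
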